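(* Let $\lambda>0$ and let the step size $\mu$ satisfy $0<\mu<\frac{1}{\|A\|_{2}^{2}}$. Let $\{x^{k}\}_{k\ge 0}\subset\mathbb{R}^n$ be a sequence generated from an initial point $x^{0}\in\mathbb{R}^{n}$ by the iteration $$x^{k+1}_{i}=\mathrm{sign}\big([B_{\mu}(x^{k})]_{i}\big)\cdot\max\Big\{\big|[B_{\mu}(x^{k})]_{i}\big|-\frac{\lambda\mu}{2(|x_{i}^{k}|+\epsilon_{i})^{1-p}},\,0\Big\},\qquad i=1,\dots,n,\ k=0,1,2,\dots$$ Then $\{x^{k}\}$ is asymptotically regular, i.e. $\lim_{k\rightarrow\infty}\|x^{k+1}-x^{k}\|_{2}^{2}=0$.
   Context: $A$ is a real $m\times n$ matrix of full row rank with $m\ll n$ (in particular $m<n$), $b\in\mathbb{R}^{m}$ is a nonzero vector, $p\in(0,1)$, and $\epsilon=(\epsilon_{1},\dots,\epsilon_{n})^{\top}\in\mathbb{R}^{n}$ has all entries $\epsilon_{i}>0$. $\|A\|_{2}$ is the spectral norm. For $z\in\mathbb{R}^{n}$, $B_{\mu}(z)=z+\mu A^{\top}(b-Az)$, and $[B_{\mu}(z)]_{i}$ is its $i$-th component. *)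

theory Defs
  imports "HOL-Analysis.Analysis"
begin

text \<open>
  The norm on \<^typ>\<open>real ^ 'n\<close> is the Euclidean one, so the operator norm of the map
  \<open>x \<mapsto> A x\<close> is the spectral norm of \<open>A\<close>.
\<close>

definition spectral_norm :: "real ^ 'n ^ 'm \<Rightarrow> real" where
  "spectral_norm A = onorm ((*v) A)"

definition B_map :: "real ^ 'n ^ 'm \<Rightarrow> real ^ 'm \<Rightarrow> real \<Rightarrow> real ^ 'n \<Rightarrow> real ^ 'n" where
  "B_map A b \<mu> z = z + \<mu> *\<^sub>R (transpose A *v (b - A *v z))"

end

theory Submission
  imports Defs
begin

text \<open>
  The potential \<open>F(z) = \<parallel>A z - b\<parallel>\<^sup>2 + (\<lambda>/p) \<Sum>\<^sub>i (|z\<^sub>i| + \<epsilon>\<^sub>i)\<^sup>p\<close> decreases along the iteration.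
  With \<open>w\<^sub>i = (|x\<^sub>i| + \<epsilon>\<^sub>i) powr (p - 1)\<close> for the current iterate \<open>x\<close>, concavity of \<open>t \<mapsto> t\<^sup>p\<close> bounds
  the penalty by its linearisation with slopes \<open>\<lambda> w\<^sub>i\<close>. The new iterate minimises the strongly convex
  function \<open>y \<mapsto> \<parallel>y - B(x)\<parallel>\<^sup>2 + \<lambda> \<mu> \<Sum>\<^sub>i w\<^sub>i |y\<^sub>i|\<close>, which yields a drop of
  \<open>(2/\<mu>) \<parallel>d\<parallel>\<^sup>2 - \<parallel>A d\<parallel>\<^sup>2 \<ge> (1/\<mu>) \<parallel>d\<parallel>\<^sup>2\<close> for the step \<open>d\<close>. Since \<open>F \<ge> 0\<close>, the drops tend to zero.
\<close>

text \<open>Soft thresholding minimises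
  \<open>z \<mapsto> (z - B)^2 + 2 * t * \<bar>z\<bar>\<close>; strong convexity supplies the extra
  \<open>(x - y)^2\<close>.\<close>

lemma soft_threshold_quadratic_growth:
  fixes B t x y :: real
  assumes "0 \<le> t" and y: "y = sgn B * max (\<bar>B\<bar> - t) 0"
  shows "(y - B)\<^sup>2 + 2 * t * \<bar>y\<bar> + (x - y)\<^sup>2 \<le> (x - B)\<^sup>2 + 2 * t * \<bar>x\<bar>"
proof -
  \<comment> \<open>Twice this quantity is the right side minus the left side. Its sign says that
    \<open>B - y\<close> is a subgradient of \<open>t * \<bar>z\<bar>\<close> at
    \<open>y\<close>.\<close>
  have "0 \<le> (x - y) * (y - B) + t * (\<bar>x\<bar> - \<bar>y\<bar>)"
  proof (cases "\<bar>B\<bar> \<le> t")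
    case True
    have "x * B \<le> \<bar>x\<bar> * \<bar>B\<bar>"
      by (metis abs_ge_self abs_mult)
    also have "\<dots> \<le> \<bar>x\<bar> * t"
      using True by (simp add: mult_left_mono)
    finally show ?thesis
      using True by (simp add: y mult.commute)
  next
    case False
    have le: "t * x \<le> t * \<bar>x\<bar>" "- (t * x) \<le> t * \<bar>x\<bar>"
      using mult_left_mono[OF _ \<open>0 \<le> t\<close>, of x "\<bar>x\<bar>"] mult_left_mono[OF _ \<open>0 \<le> t\<close>, of "- x" "\<bar>x\<bar>"]
      by simp_all
    consider "t < B" | "B < - t"
      using False by linarith
    then show ?thesis
    proof cases
      case 1
      then have "y - B = - t" "\<bar>y\<bar> = y"
        using \<open>0 \<le> t\<close> by (simp_all add: y)
      then show ?thesis
        using le(1) by (simp only:) (simp add: algebra_simps)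
    next
      case 2
      then have "y - B = t" "\<bar>y\<bar> = - y"
        using \<open>0 \<le> t\<close> by (simp_all add: y)
      then show ?thesis
        using le(2) by (simp only:) (simp add: algebra_simps)
    qed
  qed
  then show ?thesis
    by (simp add: power2_eq_square algebra_simps)
qed

text \<open>Multiplied by \<open>u powr (1 - p)\<close>, the tangent bound becomes weighted AM-GM
  with weights \<open>p\<close> and \<open>1 - p\<close>.\<close>

lemma powr_le_tangent:
  fixes u v p :: real
  assumes "0 < u" "0 < v" "0 < p" "p < 1"
  shows "v powr p \<le> u powr p + p * (v - u) / u powr (1 - p)"
proof -
  have "v powr p * u powr (1 - p) \<le> p * v + (1 - p) * u"
    using assms by (intro Youngs_inequality_0) auto
  also have "\<dots> = u powr p * u powr (1 - p) + p * (v - u)"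
    using assms by (simp add: algebra_simps flip: powr_add)
  finally show ?thesis
    using assms by (simp add: field_simps)
qed

lemma norm_matrix_vector_le_spectral_norm:
  "norm (A *v d) \<le> spectral_norm A * norm d"
  unfolding spectral_norm_def by (intro onorm matrix_vector_mul_bounded_linear)

text \<open>The factor \<open>lam / p\<close> makes the slope of the penalty in each
  \<open>\<bar>z $ i\<bar>\<close> equal to \<open>2 / \<mu>\<close> times the threshold used at
  \<open>z\<close>.\<close>

definition potential ::
  "real ^ 'n ^ 'm \<Rightarrow> real ^ 'm \<Rightarrow> real ^ 'n \<Rightarrow> real \<Rightarrow> real \<Rightarrow> real ^ 'n \<Rightarrow> real" where
  "potential A b \<epsilon> p lam z =
     (norm (A *v z - b))\<^sup>2 + lam / p * (\<Sum>i\<in>UNIV. (\<bar>z $ i\<bar> + \<epsilon> $ i) powr p)"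

lemma potential_nonneg:
  assumes "0 < p" "0 < lam"
  shows "0 \<le> potential A b \<epsilon> p lam z"
  using assms unfolding potential_def
  by (intro add_nonneg_nonneg mult_nonneg_nonneg sum_nonneg) auto

lemma potential_descent:
  fixes A :: "real ^ 'n ^ 'm" and b :: "real ^ 'm" and \<epsilon> x y :: "real ^ 'n"
  assumes p: "0 < p" "p < 1" and \<epsilon>: "\<And>i. 0 < \<epsilon> $ i" and "0 < lam"
    and \<mu>: "0 < \<mu>" "\<mu> < 1 / (spectral_norm A)\<^sup>2"
    and y: "\<And>i. y $ i = sgn (B_map A b \<mu> x $ i) *
           max (\<bar>B_map A b \<mu> x $ i\<bar> - lam * \<mu> / (2 * (\<bar>x $ i\<bar> + \<epsilon> $ i) powr (1 - p))) 0"
  shows "potential A b \<epsilon> p lam y + (norm (y - x))\<^sup>2 / \<mu> \<le> potential A b \<epsilon> p lam x"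
proof -
  define d where "d = y - x"
  \<comment> \<open>Half the gradient of the squared residual at \<open>x\<close>, so that
    \<open>B_map\<close> is a gradient step.\<close>
  define g where "g = transpose A *v (A *v x - b)"
  define Q where "Q = (\<lambda>z i. (\<bar>z $ i\<bar> + \<epsilon> $ i) powr p)" for z :: "real ^ 'n"
  have B: "B_map A b \<mu> x = x - \<mu> *\<^sub>R g"
    by (simp add: B_map_def g_def matrix_vector_mult_diff_distrib algebra_simps)
  have comp: "2 * (g $ i * d $ i) + lam / p * (Q y i - Q x i) \<le> - 2 / \<mu> * (d $ i)\<^sup>2" for i
  proof -
    define W where "W = (\<bar>x $ i\<bar> + \<epsilon> $ i) powr (1 - p)"
    have pos: "0 < \<bar>x $ i\<bar> + \<epsilon> $ i" "0 < \<bar>y $ i\<bar> + \<epsilon> $ i"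
      using \<epsilon>[of i] by auto
    then have "0 < W"
      unfolding W_def by simp
    have "Q y i \<le> Q x i + p * (\<bar>y $ i\<bar> - \<bar>x $ i\<bar>) / W"
      using powr_le_tangent[OF pos p] by (simp add: Q_def W_def)
    then have "lam / p * (Q y i - Q x i) \<le> lam / p * (p * (\<bar>y $ i\<bar> - \<bar>x $ i\<bar>) / W)"
      using p \<open>0 < lam\<close> by (intro mult_left_mono) auto
    also have "\<dots> = lam / W * (\<bar>y $ i\<bar> - \<bar>x $ i\<bar>)"
      using p by simp
    finally have pen: "lam / p * (Q y i - Q x i) \<le> lam / W * (\<bar>y $ i\<bar> - \<bar>x $ i\<bar>)" .
    have "(y $ i - B_map A b \<mu> x $ i)\<^sup>2 + 2 * (lam * \<mu> / (2 * W)) * \<bar>y $ i\<bar> + (x $ i - y $ i)\<^sup>2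
        \<le> (x $ i - B_map A b \<mu> x $ i)\<^sup>2 + 2 * (lam * \<mu> / (2 * W)) * \<bar>x $ i\<bar>"
      using \<open>0 < W\<close> \<open>0 < lam\<close> \<mu> y[of i]
      by (intro soft_threshold_quadratic_growth) (simp_all add: W_def)
    \<comment> \<open>With \<open>B = x - \<mu> g\<close> the squares of \<open>\<mu> g\<close>
      cancel. One \<open>(d $ i)^2\<close> comes from expanding \<open>(y - B)^2\<close>, the other
      from quadratic growth.\<close>
    then have "\<mu> * (2 * (g $ i * d $ i) + lam / W * (\<bar>y $ i\<bar> - \<bar>x $ i\<bar>))
        \<le> \<mu> * (- 2 / \<mu> * (d $ i)\<^sup>2)"
      using \<mu>(1) by (simp add: B d_def power2_eq_square algebra_simps)
    then have "2 * (g $ i * d $ i) + lam / W * (\<bar>y $ i\<bar> - \<bar>x $ i\<bar>) \<le> - 2 / \<mu> * (d $ i)\<^sup>2"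
      by (rule mult_left_le_imp_le[OF _ \<mu>(1)])
    with pen show ?thesis
      by linarith
  qed
  have "2 * (g \<bullet> d) + lam / p * (sum (Q y) UNIV - sum (Q x) UNIV)
      = (\<Sum>i\<in>UNIV. 2 * (g $ i * d $ i) + lam / p * (Q y i - Q x i))"
    by (simp add: inner_vec_def sum.distrib sum_distrib_left flip: sum_subtractf)
  also have "\<dots> \<le> (\<Sum>i\<in>UNIV. - 2 / \<mu> * (d $ i)\<^sup>2)"
    by (intro sum_mono comp)
  also have "\<dots> = - 2 / \<mu> * (norm d)\<^sup>2"
    by (simp only: power2_norm_eq_inner inner_vec_def sum_distrib_left) (simp add: power2_eq_square)
  finally have lin: "2 * (g \<bullet> d) + lam / p * (sum (Q y) UNIV - sum (Q x) UNIV)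
      \<le> - 2 / \<mu> * (norm d)\<^sup>2" .
  have "A *v y - b = (A *v x - b) + A *v d"
    by (simp add: d_def matrix_vector_mult_diff_distrib)
  moreover have "g \<bullet> d = (A *v x - b) \<bullet> (A *v d)"
    by (simp add: g_def dot_lmul_matrix)
  \<comment> \<open>The expansion is exact, so \<open>A *v d\<close> gives the only term not covered
    by \<open>lin\<close>.\<close>
  ultimately have quad: "(norm (A *v y - b))\<^sup>2
      = (norm (A *v x - b))\<^sup>2 + 2 * (g \<bullet> d) + (norm (A *v d))\<^sup>2"
    by (simp add: power2_norm_eq_inner inner_add inner_diff inner_commute)
  \<comment> \<open>If the spectral norm vanished, the bound on \<open>\<mu>\<close> would read \<open>\<mu> < 1 / 0 = 0\<close>.\<close>
  have "0 < (spectral_norm A)\<^sup>2"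
    using \<mu> by (cases "spectral_norm A = 0") auto
  then have "(spectral_norm A)\<^sup>2 \<le> 1 / \<mu>"
    using \<mu> by (simp add: field_simps)
  moreover have "(norm (A *v d))\<^sup>2 \<le> (spectral_norm A)\<^sup>2 * (norm d)\<^sup>2"
    using power_mono[OF norm_matrix_vector_le_spectral_norm, of A d 2]
    by (simp add: power_mult_distrib)
  \<comment> \<open>Half of the decrease in \<open>lin\<close> pays for this term; the other half
    remains.\<close>
  ultimately have "(norm (A *v d))\<^sup>2 \<le> 1 / \<mu> * (norm d)\<^sup>2"
    by (meson mult_right_mono order_trans zero_le_power2)
  with lin quad show ?thesis
    by (simp add: potential_def Q_def d_def algebra_simps)
qed

theorem theorem5:
  fixes A :: "real ^ 'n ^ 'm" and b :: "real ^ 'm" and \<epsilon> :: "real ^ 'n"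
    and p lam \<mu> :: real and x :: "nat \<Rightarrow> real ^ 'n"
  assumes "CARD('m) < CARD('n)"
    and "rank A = CARD('m)"
    and "b \<noteq> 0"
    and "0 < p" and "p < 1"
    and "\<And>i. 0 < \<epsilon> $ i"
    and "0 < lam"
    and "0 < \<mu>" and "\<mu> < 1 / (spectral_norm A)\<^sup>2"
    and "\<And>k i. x (Suc k) $ i =
           sgn (B_map A b \<mu> (x k) $ i) *
           max (\<bar>B_map A b \<mu> (x k) $ i\<bar> - lam * \<mu> / (2 * (\<bar>x k $ i\<bar> + \<epsilon> $ i) powr (1 - p))) 0"
  shows "(\<lambda>k. (norm (x (Suc k) - x k))\<^sup>2) \<longlonglongrightarrow> 0"
proof -
  define F where "F k = potential A b \<epsilon> p lam (x k)" for k
  have drop: "F (Suc k) + (norm (x (Suc k) - x k))\<^sup>2 / \<mu> \<le> F k" for k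
    unfolding F_def using assms(4-10) by (intro potential_descent)
  have "decseq F"
  proof (rule decseq_SucI)
    show "F (Suc k) \<le> F k" for k
      using \<open>0 < \<mu>\<close> by (intro order_trans[OF _ drop[of k]]) simp
  qed
  moreover have "0 \<le> F k" for k
    unfolding F_def using assms by (intro potential_nonneg)
  ultimately obtain L where "F \<longlonglongrightarrow> L"
    using decseq_convergent[of F 0] by blast
  \<comment> \<open>Consecutive differences of a convergent sequence vanish, and by
    \<open>drop\<close> they dominate the squared steps.\<close>
  then have "(\<lambda>k. \<mu> * (F k - F (Suc k))) \<longlonglongrightarrow> \<mu> * (L - L)"
    by (intro tendsto_intros LIMSEQ_Suc)
  then have lim: "(\<lambda>k. \<mu> * (F k - F (Suc k))) \<longlonglongrightarrow> 0"
    by simp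
  have "(norm (x (Suc k) - x k))\<^sup>2 \<le> \<mu> * (F k - F (Suc k))" for k
    using drop[of k] \<open>0 < \<mu>\<close> by (simp add: field_simps)
  then show ?thesis
    by (intro tendsto_sandwich[OF _ _ tendsto_const lim]) auto
qed

end
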